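(* Let $X$ be a Banach two-sided $\mathbb{H}$-module, let $D(A)$ be a right $\mathbb{H}$-submodule of $X$ and let $A : D(A)\to X$ be a closed right linear operator such that $\rho_S(A)\cap\mathbb{R}\neq\varnothing$. Let $q_0\in\rho_S(A)$, set $R:=\|Q_{q_0}(A)\|^{-1/2}>0$, and define operators $B_n\in\mathscr{L}^r(X)$ and functions $\mathfrak{p}_{q_0,n}:\mathbb{H}\to\mathbb{H}$, for $n\in\mathbb{N}$, by $$B_{2k}:=Q_{q_0}(A)^k,\quad B_{2k+1}:=Q_{q_0}(A)^kS_{q_0}^{-1}(A),\quad \mathfrak{p}_{q_0,2k}(q):=\triangle_{q_0}(q)^k,\quad \mathfrak{p}_{q_0,2k+1}(q):=(q-q_0)\triangle_{q_0}(q)^k\qquad(k\in\mathbb{N}).$$ Then: (i) $\mathrm{U}(q_0,R)\subset\rho_S(A)$. (ii) $\rho_S(A)$ is open in the Cassini topology of $\mathbb{H}$ (hence also in the Euclidean topology of $\mathbb{H}$). (iii) For every $q\in\mathrm{U}(q_0,R)$, the series $\sum_{n=0}^\infty(-1)^nB_{n+1}\mathfrak{p}_{q_0,n}(q)$ converges in $\mathscr{L}^r(X)$ and its sum is $S_q^{-1}(A)$, that is, $$S_q^{-1}(A)=\sum_{n=0}^\infty(-1)^nB_{n+1}\,\mathfrak{p}_{q_0,n}(q).$$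
   Context: $\mathbb{N}=\{0,1,2,\dots\}$. $\mathbb{H}$ is the real algebra of quaternions with conjugation $q\mapsto\overline{q}$, real part $\operatorname{Re}(q)$ and norm $|q|=\sqrt{q\overline{q}}$; $\mathbb{R}\subset\mathbb{H}$ is the set of real quaternions. A two-sided $\mathbb{H}$-module is an abelian group $X$ with left and right scalar multiplications by $\mathbb{H}$, biadditive and unital, with $p(qx)=(pq)x$, $(xp)q=x(pq)$, $p(xq)=(px)q$ for $p,q\in\mathbb{H}$, and $rx=xr$ for $r\in\mathbb{R}$. It is a Banach two-sided $\mathbb{H}$-module if it has a norm (definite, subadditive) with $\|qx\|=\|xq\|=|q|\|x\|$ for which it is complete. A right $\mathbb{H}$-submodule is a subgroup closed under right scalar multiplication. A map $A:D(A)\to X$ on a right $\mathbb{H}$-submodule is right linear if it is additive and $A(xq)=A(x)q$; it is closed if its graph is closed in $X\times X$. $D(A^n):=\{x\in D(A^{n-1}):A^{n-1}x\in D(A)\}$, $A^nx:=A(A^{n-1}x)$, $A^0=\mathrm{Id}$. Operator-scalar products: $(qB)(x):=q\,B(x)$, and, when $D(B)$ is also closed under left scalar multiplication, $(Bq)(x):=B(qx)$; juxtaposition of operators is composition. $\mathscr{L}^r(X)$ is the set of right linear $B:X\to X$ with $\|B\|:=\sup\{\|Bx\|:\|x\|\le1\}<\infty$, normed by $\|\cdot\|$. For $q\in\mathbb{H}$, $\Delta_q(A):=A^2-2\operatorname{Re}(q)A+|q|^2\mathrm{Id}:D(A^2)\to X$. $\rho_S(A):=\{q\in\mathbb{H}:\Delta_q(A)\text{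 is bijective and }\Delta_q(A)^{-1}\in\mathscr{L}^r(X)\}$. For $q\in\rho_S(A)$: $Q_q(A):=\Delta_q(A)^{-1}$ and $S_q^{-1}(A):=Q_q(A)\overline{q}-A\,Q_q(A):X\to X$, which belongs to $\mathscr{L}^r(X)$. For $p,q\in\mathbb{H}$, $\triangle_q(p):=p^2-2\operatorname{Re}(q)p+|q|^2\in\mathbb{H}$. The function $\mathrm{u}(p,q):=\sqrt{|\triangle_q(p)|}$ is a pseudo-metric on $\mathbb{H}$ (Cassini pseudo-metric); $\mathrm{U}(q_0,R):=\{p\in\mathbb{H}:\mathrm{u}(p,q_0)<R\}$, and the Cassini topology is the topology induced by $\mathrm{u}$. Convention for the degenerate case $X=\{0\}$: $0^{-1/2}:=+\infty$. *)

theory Defs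
  imports "HOL-Analysis.Analysis"
begin

section \<open>Quaternions\<close>

datatype quat = Quat (qRe: real) (qI: real) (qJ: real) (qK: real)

lemma quat_eq_iff: "p = q \<longleftrightarrow> qRe p = qRe q \<and> qI p = qI q \<and> qJ p = qJ q \<and> qK p = qK q"
  by (auto intro: quat.expand)

instantiation quat :: ab_group_add
begin

definition "0 = Quat 0 0 0 0"
definition "p + q = Quat (qRe p + qRe q) (qI p + qI q) (qJ p + qJ q) (qK p + qK q)"
definition "- q = Quat (- qRe q) (- qI q) (- qJ q) (- qK q)" for q :: quat
definition "p - q = Quat (qRe p - qRe q) (qI p - qI q) (qJ p - qJ q) (qK p - qK q)"

instance
  by standard
    (simp_all add: quat_eq_iff zero_quat_def plus_quat_def uminus_quat_def minus_quat_def)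

end

lemma zero_quat_sel [simp]: "qRe 0 = 0" "qI 0 = 0" "qJ 0 = 0" "qK 0 = 0"
  by (simp_all add: zero_quat_def)

lemma plus_quat_sel [simp]:
  "qRe (p + q) = qRe p + qRe q" "qI (p + q) = qI p + qI q"
  "qJ (p + q) = qJ p + qJ q" "qK (p + q) = qK p + qK q"
  by (simp_all add: plus_quat_def)

lemma uminus_quat_sel [simp]:
  "qRe (- q) = - qRe q" "qI (- q) = - qI q" "qJ (- q) = - qJ q" "qK (- q) = - qK q"
  by (simp_all add: uminus_quat_def)

lemma minus_quat_sel [simp]:
  "qRe (p - q) = qRe p - qRe q" "qI (p - q) = qI p - qI q"
  "qJ (p - q) = qJ p - qJ q" "qK (p - q) = qK p - qK q"
  by (simp_all add: minus_quat_def)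

lemma quat_sum_squares_eq_0:
  "(qRe q)\<^sup>2 + (qI q)\<^sup>2 + (qJ q)\<^sup>2 + (qK q)\<^sup>2 = 0 \<longleftrightarrow> q = 0"
  by (auto simp: quat_eq_iff add_nonneg_eq_0_iff)

instantiation quat :: real_algebra_1
begin

definition "1 = Quat 1 0 0 0"
definition "p * q = Quat
  (qRe p * qRe q - qI p * qI q - qJ p * qJ q - qK p * qK q)
  (qRe p * qI q + qI p * qRe q + qJ p * qK q - qK p * qJ q)
  (qRe p * qJ q - qI p * qK q + qJ p * qRe q + qK p * qI q)
  (qRe p * qK q + qI p * qJ q - qJ p * qI q + qK p * qRe q)"
definition "r *\<^sub>R q = Quat (r * qRe q) (r * qI q) (r * qJ q) (r * qK q)" for q :: quat

instance
  by standard
    (simp_all add: quat_eq_iff one_quat_def times_quat_def scaleR_quat_def algebra_simps)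

end

lemma one_quat_sel [simp]: "qRe 1 = 1" "qI 1 = 0" "qJ 1 = 0" "qK 1 = 0"
  by (simp_all add: one_quat_def)

lemma times_quat_sel [simp]:
  "qRe (p * q) = qRe p * qRe q - qI p * qI q - qJ p * qJ q - qK p * qK q"
  "qI (p * q) = qRe p * qI q + qI p * qRe q + qJ p * qK q - qK p * qJ q"
  "qJ (p * q) = qRe p * qJ q - qI p * qK q + qJ p * qRe q + qK p * qI q"
  "qK (p * q) = qRe p * qK q + qI p * qJ q - qJ p * qI q + qK p * qRe q"
  by (simp_all add: times_quat_def)

lemma scaleR_quat_sel [simp]:
  "qRe (r *\<^sub>R q) = r * qRe q" "qI (r *\<^sub>R q) = r * qI q"
  "qJ (r *\<^sub>R q) = r * qJ q" "qK (r *\<^sub>R q) = r * qK q"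
  by (simp_all add: scaleR_quat_def)

lemma of_real_quat_sel [simp]:
  "qRe (of_real r) = r" "qI (of_real r) = 0" "qJ (of_real r) = 0" "qK (of_real r) = 0"
  by (simp_all add: of_real_def)

definition qcnj :: "quat \<Rightarrow> quat" where
  "qcnj q = Quat (qRe q) (- qI q) (- qJ q) (- qK q)"

lemma qcnj_sel [simp]:
  "qRe (qcnj q) = qRe q" "qI (qcnj q) = - qI q" "qJ (qcnj q) = - qJ q" "qK (qcnj q) = - qK q"
  by (simp_all add: qcnj_def)

instantiation quat :: division_ring
begin

definition "inverse q = (1 / ((qRe q)\<^sup>2 + (qI q)\<^sup>2 + (qJ q)\<^sup>2 + (qK q)\<^sup>2)) *\<^sub>R qcnj q"
definition "p div q = p * inverse q" for p q :: quat

instance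
proof
  fix p q :: quat
  show "inverse q * q = 1" "q * inverse q = 1" if "q \<noteq> 0"
  proof -
    let ?s = "(qRe q)\<^sup>2 + (qI q)\<^sup>2 + (qJ q)\<^sup>2 + (qK q)\<^sup>2"
    have "?s \<noteq> 0"
      using that by (simp add: quat_sum_squares_eq_0)
    moreover have "qcnj q * q = of_real ?s" "q * qcnj q = of_real ?s"
      by (simp_all add: quat_eq_iff power2_eq_square)
    ultimately show "inverse q * q = 1" "q * inverse q = 1"
      by (simp_all add: inverse_quat_def of_real_def)
  qed
  show "p div q = p * inverse q"
    by (simp add: divide_quat_def)
  show "inverse 0 = (0 :: quat)"
    by (simp add: inverse_quat_def quat_eq_iff)
qed

end

instantiation quat :: real_normed_div_algebra
begin

definition "norm q = sqrt ((qRe q)\<^sup>2 + (qI q)\<^sup>2 + (qJ q)\<^sup>2 + (qK q)\<^sup>2)"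
definition sgn_quat_def: "sgn q = q /\<^sub>R norm q" for q :: quat
definition dist_quat_def: "dist p q = norm (p - q)" for p q :: quat
definition uniformity_quat_def [code del]:
  "(uniformity :: (quat \<times> quat) filter) = (INF e\<in>{0 <..}. principal {(x, y). dist x y < e})"
definition open_quat_def [code del]:
  "open (U :: quat set) \<longleftrightarrow> (\<forall>x\<in>U. eventually (\<lambda>(x', y). x' = x \<longrightarrow> y \<in> U) uniformity)"

instance
proof
  fix r :: real and p q :: quat and U :: "quat set"
  show "norm q = 0 \<longleftrightarrow> q = 0"
    by (simp add: norm_quat_def quat_sum_squares_eq_0)
  show "norm (p + q) \<le> norm p + norm q"
  proof -
    have *: "norm x = norm ((qRe x, qI x), (qJ x, qK x))" for x
      by (simp add: norm_quat_def norm_Pair algebra_simps)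
    show ?thesis
      unfolding * using norm_triangle_ineq[of "((qRe p, qI p), (qJ p, qK p))" "((qRe q, qI q), (qJ q, qK q))"]
      by simp
  qed
  show "norm (r *\<^sub>R q) = \<bar>r\<bar> * norm q"
    by (simp add: norm_quat_def power_mult_distrib distrib_left[symmetric] real_sqrt_mult)
  show "norm (p * q) = norm p * norm q"
    unfolding norm_quat_def real_sqrt_mult[symmetric]
    by (rule arg_cong[of _ _ sqrt]) (simp add: power2_eq_square algebra_simps)
  show "sgn q = q /\<^sub>R norm q" "dist p q = norm (p - q)"
    "open U \<longleftrightarrow> (\<forall>x\<in>U. eventually (\<lambda>(x', y). x' = x \<longrightarrow> y \<in> U) uniformity)"
    "(uniformity :: (quat \<times> quat) filter) = (INF e\<in>{0 <..}. principal {(x, y). dist x y < e})"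
    by (simp_all only: sgn_quat_def dist_quat_def open_quat_def uniformity_quat_def)
qed

end

lemma mult_qcnj: "q * qcnj q = of_real ((norm q)\<^sup>2)"
  by (simp add: quat_eq_iff norm_quat_def power2_eq_square)


section \<open>Banach two-sided quaternionic modules\<close>

class quat_bimodule = ab_group_add +
  fixes lscale :: "quat \<Rightarrow> 'a \<Rightarrow> 'a" (infixr \<open>*\<^sub>l\<close> 75)
    and rscale :: "'a \<Rightarrow> quat \<Rightarrow> 'a" (infixl \<open>*\<^sub>r\<close> 75)
  assumes lscale_add_right: "q *\<^sub>l (x + y) = q *\<^sub>l x + q *\<^sub>l y"
    and lscale_add_left: "(p + q) *\<^sub>l x = p *\<^sub>l x + q *\<^sub>l x"
    and rscale_add_left: "(x + y) *\<^sub>r q = x *\<^sub>r q + y *\<^sub>r q"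
    and rscale_add_right: "x *\<^sub>r (p + q) = x *\<^sub>r p + x *\<^sub>r q"
    and lscale_one: "1 *\<^sub>l x = x"
    and rscale_one: "x *\<^sub>r 1 = x"
    and lscale_lscale: "p *\<^sub>l (q *\<^sub>l x) = (p * q) *\<^sub>l x"
    and rscale_rscale: "(x *\<^sub>r p) *\<^sub>r q = x *\<^sub>r (p * q)"
    and lscale_rscale: "p *\<^sub>l (x *\<^sub>r q) = (p *\<^sub>l x) *\<^sub>r q"
    and lscale_real_eq_rscale: "r \<in> \<real> \<Longrightarrow> r *\<^sub>l x = x *\<^sub>r r"

text \<open>The real vector space structure required by \<^class>\<open>banach\<close> is no additional datum: the
  first axiom says that it is the one obtained by restricting the scalars to the real quaternions.\<close>

class banach_quat_bimodule = quat_bimodule + banach +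
  assumes scaleR_eq_lscale: "r *\<^sub>R x = of_real r *\<^sub>l x"
    and norm_lscale: "norm (q *\<^sub>l x) = norm q * norm x"
    and norm_rscale: "norm (x *\<^sub>r q) = norm q * norm x"


section \<open>Right linear operators\<close>

text \<open>An operator \<open>A : D(A) \<rightarrow> X\<close> is given by its domain \<open>D\<close> together with a function \<open>A\<close>, whose
  values outside \<open>D\<close> are irrelevant in all of the following notions.\<close>

definition right_submodule :: "'a::quat_bimodule set \<Rightarrow> bool" where
  "right_submodule D \<longleftrightarrow>
     0 \<in> D \<and> (\<forall>x\<in>D. \<forall>y\<in>D. x + y \<in> D) \<and> (\<forall>x\<in>D. - x \<in> D) \<and> (\<forall>x\<in>D. \<forall>q. x *\<^sub>r q \<in> D)"

definition right_linear_on :: "'a::quat_bimodule set \<Rightarrow> ('a \<Rightarrow> 'a) \<Rightarrow> bool" where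
  "right_linear_on D A \<longleftrightarrow>
     (\<forall>x\<in>D. \<forall>y\<in>D. A (x + y) = A x + A y) \<and> (\<forall>x\<in>D. \<forall>q. A (x *\<^sub>r q) = A x *\<^sub>r q)"

definition closed_operator :: "'a::banach_quat_bimodule set \<Rightarrow> ('a \<Rightarrow> 'a) \<Rightarrow> bool" where
  "closed_operator D A \<longleftrightarrow> closed {(x, A x) | x. x \<in> D}"

text \<open>The domain of the \<open>n\<close>-th power of \<open>A\<close>; the power itself is \<open>A ^^ n\<close>.\<close>

fun pow_dom :: "'a set \<Rightarrow> ('a \<Rightarrow> 'a) \<Rightarrow> nat \<Rightarrow> 'a set" where
  "pow_dom D A 0 = UNIV"
| "pow_dom D A (Suc n) = {x \<in> pow_dom D A n. (A ^^ n) x \<in> D}"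

definition opnorm :: "('a::banach_quat_bimodule \<Rightarrow> 'a) \<Rightarrow> real" where
  "opnorm B = Sup {norm (B x) | x. norm x \<le> 1}"

definition bounded_right_linear :: "('a::banach_quat_bimodule \<Rightarrow> 'a) set" where
  "bounded_right_linear = {B. right_linear_on UNIV B \<and> bdd_above {norm (B x) | x. norm x \<le> 1}}"

text \<open>Convergence of the series of the operators \<open>F n\<close> to \<open>S\<close> in the normed space
  \<^const>\<open>bounded_right_linear\<close>.\<close>

definition op_sums :: "(nat \<Rightarrow> 'a \<Rightarrow> 'a) \<Rightarrow> ('a::banach_quat_bimodule \<Rightarrow> 'a) \<Rightarrow> bool" where
  "op_sums F S \<longleftrightarrow>
     (\<forall>n. F n \<in> bounded_right_linear) \<and> S \<in> bounded_right_linear \<and>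
     (\<lambda>N. opnorm (\<lambda>x. (\<Sum>n<N. F n x) - S x)) \<longlonglongrightarrow> 0"

definition lscale_op :: "quat \<Rightarrow> ('a \<Rightarrow> 'a) \<Rightarrow> 'a \<Rightarrow> 'a::quat_bimodule" where
  "lscale_op q B = (\<lambda>x. q *\<^sub>l B x)"

definition rscale_op :: "('a \<Rightarrow> 'a) \<Rightarrow> quat \<Rightarrow> 'a \<Rightarrow> 'a::quat_bimodule" where
  "rscale_op B q = (\<lambda>x. B (q *\<^sub>l x))"


section \<open>Spherical resolvent set and resolvent operators\<close>

definition Delta_op :: "('a \<Rightarrow> 'a) \<Rightarrow> quat \<Rightarrow> 'a \<Rightarrow> 'a::banach_quat_bimodule" where
  "Delta_op A q x =
     (A ^^ 2) x - lscale_op (of_real (2 * qRe q)) A x + lscale_op (of_real ((norm q)\<^sup>2)) id x"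

definition Q_op :: "'a set \<Rightarrow> ('a \<Rightarrow> 'a) \<Rightarrow> quat \<Rightarrow> 'a \<Rightarrow> 'a::banach_quat_bimodule" where
  "Q_op D A q = inv_into (pow_dom D A 2) (Delta_op A q)"

definition S_resolvent_set :: "'a::banach_quat_bimodule set \<Rightarrow> ('a \<Rightarrow> 'a) \<Rightarrow> quat set" where
  "S_resolvent_set D A =
     {q. bij_betw (Delta_op A q) (pow_dom D A 2) UNIV \<and> Q_op D A q \<in> bounded_right_linear}"

definition S_resolvent_op :: "'a set \<Rightarrow> ('a \<Rightarrow> 'a) \<Rightarrow> quat \<Rightarrow> 'a \<Rightarrow> 'a::banach_quat_bimodule" where
  "S_resolvent_op D A q x = rscale_op (Q_op D A q) (qcnj q) x - (A \<circ> Q_op D A q) x"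


section \<open>Cassini pseudo-metric\<close>

definition delta_quat :: "quat \<Rightarrow> quat \<Rightarrow> quat" where
  "delta_quat q p = p\<^sup>2 - of_real (2 * qRe q) * p + of_real ((norm q)\<^sup>2)"

definition cassini :: "quat \<Rightarrow> quat \<Rightarrow> real" where
  "cassini p q = sqrt (norm (delta_quat q p))"

definition cassini_ball :: "quat \<Rightarrow> ereal \<Rightarrow> quat set" where
  "cassini_ball q R = {p. ereal (cassini p q) < R}"

definition cassini_topology :: "quat topology" where
  "cassini_topology = topology (\<lambda>V. \<forall>p\<in>V. \<exists>r>0. cassini_ball p (ereal r) \<subseteq> V)"

lemma openin_cassini_topology:
  "openin cassini_topology V \<longleftrightarrow> (\<forall>p\<in>V. \<exists>r>0. cassini_ball p (ereal r) \<subseteq> V)"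
proof -
  have "istopology (\<lambda>V. \<forall>p\<in>V. \<exists>r>0. cassini_ball p (ereal r) \<subseteq> V)"
    unfolding istopology_def
  proof (intro conjI allI impI)
    fix V W
    assume *: "\<forall>p\<in>V. \<exists>r>0. cassini_ball p (ereal r) \<subseteq> V"
      "\<forall>p\<in>W. \<exists>r>0. cassini_ball p (ereal r) \<subseteq> W"
    show "\<forall>p\<in>V \<inter> W. \<exists>r>0. cassini_ball p (ereal r) \<subseteq> V \<inter> W"
    proof
      fix p assume "p \<in> V \<inter> W"
      then obtain r s where "r > 0" "cassini_ball p (ereal r) \<subseteq> V"
        "s > 0" "cassini_ball p (ereal s) \<subseteq> W"
        using * by blast
      then show "\<exists>r>0. cassini_ball p (ereal r) \<subseteq> V \<inter> W"
        by (intro exI[of _ "min r s"]) (auto simp: cassini_ball_def)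
    qed
  next
    fix K :: "quat set set"
    assume "\<forall>V\<in>K. \<forall>p\<in>V. \<exists>r>0. cassini_ball p (ereal r) \<subseteq> V"
    then show "\<forall>p\<in>\<Union> K. \<exists>r>0. cassini_ball p (ereal r) \<subseteq> \<Union> K"
      by (meson Sup_upper UnionE order_trans)
  qed
  then show ?thesis
    by (simp add: cassini_topology_def)
qed


section \<open>The spherical series\<close>

text \<open>\<open>t \<mapsto> t\<^bsup>-1/2\<^esup>\<close> with the convention \<open>0\<^bsup>-1/2\<^esup> = \<infinity>\<close> (it is used at \<open>0\<close> only if \<open>X = {0}\<close>).\<close>

definition inv_sqrt :: "real \<Rightarrow> ereal" where
  "inv_sqrt t = (if t = 0 then \<infinity> else ereal (t powr (-1/2)))"

definition B_op :: "'a set \<Rightarrow> ('a \<Rightarrow> 'a) \<Rightarrow> quat \<Rightarrow> nat \<Rightarrow> 'a \<Rightarrow> 'a::banach_quat_bimodule" where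
  "B_op D A q\<^sub>0 n =
     (if even n then Q_op D A q\<^sub>0 ^^ (n div 2)
      else (Q_op D A q\<^sub>0 ^^ (n div 2)) \<circ> S_resolvent_op D A q\<^sub>0)"

definition p_fun :: "quat \<Rightarrow> nat \<Rightarrow> quat \<Rightarrow> quat" where
  "p_fun q\<^sub>0 n q =
     (if even n then delta_quat q\<^sub>0 q ^ (n div 2)
      else (q - q\<^sub>0) * delta_quat q\<^sub>0 q ^ (n div 2))"

end

theory Submission
  imports Defs
begin

text \<open>
  Write \<open>\<delta> = \<triangle>\<^bsub>q\<^sub>0\<^esub>(q)\<close> and \<open>q' = 2 Re(q\<^sub>0) - q\<close>, so that \<open>q q' = q' q = |q\<^sub>0|\<^sup>2 - \<delta>\<close>. The ball
  \<open>U(q\<^sub>0, R)\<close> is the set of all \<open>q\<close> with \<open>\<parallel>Q\<^bsub>q\<^sub>0\<^esub>(A)\<parallel> |\<delta>| < 1\<close>. For such \<open>q\<close>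
  the map \<open>x \<mapsto> Q\<^bsub>q\<^sub>0\<^esub>(A) (x \<delta>)\<close> is a contraction, which gives the invertibility of \<open>\<Delta>\<^sub>q(A)\<close>, and
  the norms of the terms of the series are dominated by a geometric series.

  Right multiplication \<open>x \<mapsto> x q\<close> commutes with the right linear \<open>A\<close>, so the polynomials factor
  as over a commutative field:
  \<open>\<Delta>\<^bsub>q\<^sub>0\<^esub>(A) x - x \<delta> = (A - q') (A - q) x\<close> on \<open>D(A\<^sup>2)\<close>, with \<open>q\<close> and \<open>q'\<close> acting from the right
  and in either order (\<open>Delta_op_factor\<close>). The left side is bijective, because solving
  \<open>\<Delta>\<^bsub>q\<^sub>0\<^esub>(A) x - x \<delta> = y\<close> means finding the fixed point of the contraction
  \<open>x \<mapsto> Q\<^bsub>q\<^sub>0\<^esub>(A) (y + x \<delta>)\<close>. Hence \<open>x \<mapsto> A x - x q\<close> is a bijection from \<open>D(A)\<close> onto \<open>X\<close>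
  (\<open>shift_bij\<close>). As \<open>\<triangle>\<^bsub>q\<^sub>0\<^esub>\<close> takes conjugate values at conjugate points, the same is true of the
  conjugate of \<open>q\<close>; and \<open>\<Delta>\<^sub>q(A)\<close> is the product of these two bijections, by the factorization with
  \<open>q\<^sub>0 = q\<close>. Boundedness of the inverses comes from the closed graph theorem. Both notions of
  openness follow, the Euclidean one because the Cassini pseudo-metric is continuous.

  The series is identified by an equation. The operator \<open>S\<^sub>q\<^sup>-\<^sup>1(A)\<close> is the only linear solution \<open>T\<close> of
  \<open>T(q x) - A T x = x\<close> with values in \<open>D(A)\<close>: the difference \<open>Y\<close> of two solutions satisfies
  \<open>A Y x = Y(q x)\<close>, hence \<open>\<Delta>\<^sub>q(A) Y x = Y(\<triangle>\<^sub>q(q) x) = 0\<close>. Adding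
  the terms of the series with the indices \<open>2k\<close> and \<open>2k + 1\<close> gives
  \<open>Q\<^sup>k\<^sup>+\<^sup>1(\<delta>\<^sup>k q' x) - A Q\<^sup>k\<^sup>+\<^sup>1(\<delta>\<^sup>k x)\<close> with \<open>Q = Q\<^bsub>q\<^sub>0\<^esub>(A)\<close>, so the sum is \<open>T x = W(q' x) - A W x\<close>
  for \<open>W x = \<Sum>\<^sub>k Q\<^sup>k\<^sup>+\<^sup>1(\<delta>\<^sup>k x)\<close>. Since \<open>\<Delta>\<^bsub>q\<^sub>0\<^esub>(A) W x - W(\<delta> x) = x\<close>, a
  computation (\<open>S_equation\<close>) shows that \<open>T\<close> solves the equation.
\<close>

section \<open>The closed graph theorem\<close>

text \<open>By Baire's theorem the closure of some \<open>{x. \<parallel>T x\<parallel> \<le> n}\<close> contains a ball. Translating it to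
  the origin and rescaling, every \<open>x\<close> is approximated within \<open>\<parallel>x\<parallel> / 2\<close> by some \<open>u\<close> with
  \<open>\<parallel>T u\<parallel> \<le> K \<parallel>x\<parallel>\<close>. Approximating the remainders again and again writes \<open>x\<close> as a series whose
  image is dominated by a geometric series; closedness identifies the sum of the image
  with \<open>T x\<close>.\<close>

lemma closed_graph_theorem:
  fixes T :: "'a::banach \<Rightarrow> 'b::banach"
  assumes "linear T" and graph: "\<And>u x y. u \<longlonglongrightarrow> x \<Longrightarrow> (\<lambda>n. T (u n)) \<longlonglongrightarrow> y \<Longrightarrow> T x = y"
  shows "bounded_linear T"
proof -
  interpret T: linear T by fact
  define E where "E n = {x. norm (T x) \<le> real n}" for n :: nat
  have "\<exists>n. interior (closure (E n)) \<noteq> {}"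
  proof (rule ccontr)
    assume "\<nexists>n. interior (closure (E n)) \<noteq> {}"
    then have "euclidean interior_of \<Union> (range (\<lambda>n. closure (E n))) = {}"
      by (intro Baire_category_alt) (auto simp: completely_metrizable_space_euclidean)
    moreover have "x \<in> \<Union> (range (\<lambda>n. closure (E n)))" for x
    proof -
      obtain n where "norm (T x) \<le> real n"
        using real_arch_simple by blast
      then show ?thesis
        using closure_subset[of "E n"] by (auto simp: E_def)
    qed
    ultimately show False
      by (metis UNIV_eq_I UNIV_not_empty interior_of_topspace topspace_euclidean)
  qed
  then obtain n a r where r: "r > 0" "ball a r \<subseteq> closure (E n)"
    by (metis all_not_in_conv mem_interior)
  define K where "K = 4 * real n / r"
  have "\<exists>u. norm (x - u) \<le> norm x / 2 \<and> norm (T u) \<le> K * norm x" for x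
  proof (cases "x = 0")
    case True
    then show ?thesis
      by (intro exI[of _ 0]) (simp add: T.zero)
  next
    case False
    \<comment> \<open>with this factor \<open>t x\<close> has norm \<open>r / 2\<close>, so that \<open>t x + a\<close> lies in the ball\<close>
    define t where "t = r / (2 * norm x)"
    have t: "t > 0" and tx: "norm (t *\<^sub>R x) < r"
      using False r(1) by (simp_all add: t_def)
    have "t *\<^sub>R x + a \<in> closure (E n)" "a \<in> closure (E n)"
      using tx r by (auto simp: subset_iff dist_norm)
    moreover have e: "t * norm x / 4 > 0"
      using False t by simp
    ultimately obtain v w where
      v: "v \<in> E n" "dist v (t *\<^sub>R x + a) < t * norm x / 4" and
      w: "w \<in> E n" "dist w a < t * norm x / 4"
      by (meson closure_approachable)
    have "norm (t *\<^sub>R x - (v - w)) \<le> dist v (t *\<^sub>R x + a) + dist w a"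
      using norm_triangle_ineq4[of "w - a" "v - (t *\<^sub>R x + a)"]
      by (simp add: dist_norm algebra_simps)
    then have 1: "norm (t *\<^sub>R x - (v - w)) \<le> t * norm x / 2"
      using v w by simp
    have "norm (T v - T w) \<le> 2 * real n"
      using v(1) w(1) norm_triangle_ineq4[of "T v" "T w"] by (simp add: E_def)
    then have 2: "norm (T (v - w)) \<le> 2 * real n"
      by (simp add: T.diff)
    have "x - (v - w) /\<^sub>R t = (t *\<^sub>R x - (v - w)) /\<^sub>R t"
      using t by (simp add: scaleR_right_diff_distrib)
    then have "norm (x - (v - w) /\<^sub>R t) = norm (t *\<^sub>R x - (v - w)) / t"
      using t by (simp only: norm_scaleR) (simp add: divide_inverse)
    also have "\<dots> \<le> t * norm x / 2 / t"
      using 1 t by (intro divide_right_mono) auto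
    also have "\<dots> = norm x / 2"
      using t by simp
    finally have "norm (x - (v - w) /\<^sub>R t) \<le> norm x / 2" .
    moreover have "norm (T ((v - w) /\<^sub>R t)) \<le> K * norm x"
    proof -
      have "norm (T ((v - w) /\<^sub>R t)) = norm (T (v - w)) / t"
        using t by (simp only: T.scaleR norm_scaleR) (simp add: divide_inverse)
      also have "\<dots> \<le> 2 * real n / t"
        using 2 t by (intro divide_right_mono) auto
      also have "\<dots> = K * norm x"
        using False r(1) by (simp add: K_def t_def)
      finally show ?thesis .
    qed
    ultimately show ?thesis
      by blast
  qed
  then obtain u where u: "norm (x - u x) \<le> norm x / 2" "norm (T (u x)) \<le> K * norm x" for x
    by metis
  have "norm (T x) \<le> norm x * (2 * K)" for x
  proof -
    \<comment> \<open>the remainder after \<open>k\<close> approximations\<close>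
    define s where "s k = ((\<lambda>x. x - u x) ^^ k) x" for k
    have s_Suc: "s (Suc k) = s k - u (s k)" and s_0: "s 0 = x" for k
      by (simp_all add: s_def)
    have s_le: "norm (s k) \<le> norm x * (1/2) ^ k" for k
      using u(1) by (induction k) (auto simp: s_0 s_Suc intro: order.trans)
    have K: "K \<ge> 0"
      using r(1) by (simp add: K_def)
    have le: "norm (T (u (s k))) \<le> (K * norm x) * (1/2) ^ k" for k
      using u(2)[of "s k"] mult_left_mono[OF s_le[of k] K] by simp
    have sums: "(\<lambda>k. (K * norm x) * (1/2) ^ k) sums (K * norm x * 2)"
      using geometric_sums[of "1/2 :: real"] by (intro sums_mult) simp
    have summable: "summable (\<lambda>k. T (u (s k)))"
      using le sums by (intro summable_comparison_test[OF _ sums_summable[OF sums]]) auto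
    have "(\<lambda>k. norm x * (1/2) ^ k) \<longlonglongrightarrow> 0"
      using tendsto_mult[OF tendsto_const[of "norm x"] LIMSEQ_realpow_zero[of "1/2"]] by simp
    then have "s \<longlonglongrightarrow> 0"
      using s_le by (intro Lim_null_comparison[of s]) auto
    then have "(\<lambda>k. x - s k) \<longlonglongrightarrow> x"
      using tendsto_diff[OF tendsto_const[of x]] by fastforce
    moreover have "T (x - s k) = (\<Sum>j<k. T (u (s j)))" for k
      by (induction k) (simp_all add: s_0 s_Suc T.zero T.diff T.add algebra_simps)
    then have "(\<lambda>k. T (x - s k)) \<longlonglongrightarrow> (\<Sum>k. T (u (s k)))"
      using summable by (simp add: summable_LIMSEQ)
    ultimately have "T x = (\<Sum>k. T (u (s k)))"
      by (rule graph)
    also have "norm \<dots> \<le> (\<Sum>k. (K * norm x) * (1/2) ^ k)"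
      using le by (intro norm_suminf_le sums_summable[OF sums]) auto
    finally show ?thesis
      using sums_unique[OF sums] by (simp add: mult_ac)
  qed
  then show ?thesis
    by (intro bounded_linear_intro[where K = "2 * K"] T.add T.scaleR)
qed


section \<open>Quaternions\<close>

lemma quat_numeral_sel [simp]:
  "qRe (numeral n) = numeral n" "qI (numeral n) = 0" "qJ (numeral n) = 0" "qK (numeral n) = 0"
  using of_real_quat_sel[of "numeral n"] by simp_all

lemma norm_qcnj [simp]: "norm (qcnj q) = norm q"
  by (simp add: norm_quat_def)

lemma add_qcnj: "q + qcnj q = of_real (2 * qRe q)"
  by (simp add: quat_eq_iff)

lemma delta_quat_qcnj: "delta_quat q\<^sub>0 (qcnj q) = qcnj (delta_quat q\<^sub>0 q)"
  by (simp add: quat_eq_iff delta_quat_def power2_eq_square)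

lemma delta_quat_self [simp]: "delta_quat q q = 0"
  by (simp add: quat_eq_iff delta_quat_def norm_quat_def power2_eq_square)

text \<open>The quaternion \<open>q' = 2 Re(q\<^sub>0) - q\<close> is the second root of the real polynomial
  \<open>X\<^sup>2 - 2 Re(q\<^sub>0) X + |q\<^sub>0|\<^sup>2 - \<delta>\<close> which has the root \<open>q\<close> if \<open>\<delta> = \<triangle>\<^bsub>q\<^sub>0\<^esub>(q)\<close> is treated as a scalar. This is
  legitimate because \<open>q\<close>, \<open>q'\<close> and \<open>\<delta>\<close> commute, all being real polynomials in \<open>q\<close>.\<close>

lemma delta_quat_reflect: "delta_quat q\<^sub>0 (of_real (2 * qRe q\<^sub>0) - q) = delta_quat q\<^sub>0 q"
  by (simp add: quat_eq_iff delta_quat_def power2_eq_square algebra_simps)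

lemma mult_reflect:
  "q * (of_real (2 * qRe q\<^sub>0) - q) = of_real ((norm q\<^sub>0)\<^sup>2) - delta_quat q\<^sub>0 q"
  "(of_real (2 * qRe q\<^sub>0) - q) * q = of_real ((norm q\<^sub>0)\<^sup>2) - delta_quat q\<^sub>0 q"
  by (simp_all add: quat_eq_iff delta_quat_def power2_eq_square algebra_simps)

lemma delta_quat_commute_reflect:
  "delta_quat q\<^sub>0 q * (of_real (2 * qRe q\<^sub>0) - q) = (of_real (2 * qRe q\<^sub>0) - q) * delta_quat q\<^sub>0 q"
  by (simp add: quat_eq_iff delta_quat_def power2_eq_square algebra_simps)

section \<open>Scalar multiplication\<close>

lemma lscale_of_real: "of_real r *\<^sub>l x = r *\<^sub>R (x::'a::banach_quat_bimodule)"
  by (simp add: scaleR_eq_lscale)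

lemma rscale_of_real: "x *\<^sub>r of_real r = r *\<^sub>R (x::'a::banach_quat_bimodule)"
  by (simp add: scaleR_eq_lscale lscale_real_eq_rscale)

lemma lscale_scaleR: "q *\<^sub>l (r *\<^sub>R x) = r *\<^sub>R (q *\<^sub>l (x::'a::banach_quat_bimodule))"
  by (metis lscale_rscale rscale_of_real)

lemma rscale_scaleR: "(r *\<^sub>R x) *\<^sub>r q = r *\<^sub>R ((x::'a::banach_quat_bimodule) *\<^sub>r q)"
  by (metis lscale_rscale lscale_of_real)

lemma bounded_linear_lscale: "bounded_linear (\<lambda>x::'a::banach_quat_bimodule. q *\<^sub>l x)"
  by (intro bounded_linear_intro[where K = "norm q"])
    (simp_all add: lscale_add_right lscale_scaleR norm_lscale)

lemma bounded_linear_rscale: "bounded_linear (\<lambda>x::'a::banach_quat_bimodule. x *\<^sub>r q)"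
  by (intro bounded_linear_intro[where K = "norm q"])
    (simp_all add: rscale_add_left rscale_scaleR norm_rscale)

lemma lscale_diff_left: "(p - q) *\<^sub>l x = p *\<^sub>l x - q *\<^sub>l (x::'a::quat_bimodule)"
  using lscale_add_left[of "p - q" q x] by simp

lemma rscale_diff_right: "x *\<^sub>r (p - q) = x *\<^sub>r p - (x::'a::quat_bimodule) *\<^sub>r q"
  using rscale_add_right[of x "p - q" q] by simp

lemma lscale_zero_left [simp]: "0 *\<^sub>l x = (0::'a::quat_bimodule)"
  using lscale_diff_left[of 0 0 x] by simp

lemma rscale_zero_right [simp]: "x *\<^sub>r 0 = (0::'a::quat_bimodule)"
  using rscale_diff_right[of x 0 0] by simp

lemmas rscale_diff_left = linear_diff[OF bounded_linear.linear[OF bounded_linear_rscale]]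
lemmas rscale_zero_left [simp] = linear_0[OF bounded_linear.linear[OF bounded_linear_rscale]]

section \<open>Bounded right linear operators\<close>

lemma bounded_right_linear_iff:
  "B \<in> bounded_right_linear \<longleftrightarrow> bounded_linear B \<and> (\<forall>x q. B (x *\<^sub>r q) = B x *\<^sub>r q)"
proof (intro iffI conjI)
  assume B: "B \<in> bounded_right_linear"
  then have add: "B (x + y) = B x + B y" and rs: "B (x *\<^sub>r q) = B x *\<^sub>r q" for x y q
    by (simp_all add: bounded_right_linear_def right_linear_on_def)
  have scaleR: "B (r *\<^sub>R x) = r *\<^sub>R B x" for r x
    by (metis rs rscale_of_real)
  obtain K where K: "norm (B x) \<le> K" if "norm x \<le> 1" for x
    using B unfolding bounded_right_linear_def bdd_above_def by blast
  have "norm (B x) \<le> norm x * K" for x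
  proof (cases "x = 0")
    case True
    then show ?thesis
      using scaleR[of 0 0] by simp
  next
    case False
    then show ?thesis
      using K[of "x /\<^sub>R norm x"] by (simp add: scaleR field_simps)
  qed
  then show "bounded_linear B"
    using add scaleR by (intro bounded_linear_intro)
  show "\<forall>x q. B (x *\<^sub>r q) = B x *\<^sub>r q"
    using rs by blast
next
  assume *: "bounded_linear B \<and> (\<forall>x q. B (x *\<^sub>r q) = B x *\<^sub>r q)"
  then obtain K where K: "K \<ge> 0" "\<And>x. norm (B x) \<le> norm x * K"
    using bounded_linear.nonneg_bounded by blast
  have "norm (B x) \<le> K" if "norm x \<le> 1" for x
    using K(2)[of x] mult_right_mono[OF that K(1)] by simp
  then have "bdd_above {norm (B x) | x. norm x \<le> 1}"
    by (intro bdd_aboveI[of _ K]) auto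
  then show "B \<in> bounded_right_linear"
    using * by (simp add: bounded_right_linear_def right_linear_on_def linear_add bounded_linear.linear)
qed

lemma opnorm_eq_onorm:
  assumes "bounded_linear (B :: 'a::banach_quat_bimodule \<Rightarrow> 'a)"
  shows "opnorm B = onorm B"
proof (rule antisym)
  interpret B: bounded_linear B by fact
  have le: "norm (B x) \<le> onorm B" if "norm x \<le> 1" for x
    using onorm[OF assms, of x] mult_left_le[OF that onorm_pos_le[OF assms]] by linarith
  then show "opnorm B \<le> onorm B"
    unfolding opnorm_def by (intro cSup_least) (auto intro: exI[of _ 0])
  have bdd: "bdd_above {norm (B x) | x. norm x \<le> 1}"
    using le by (auto intro!: bdd_aboveI)
  have *: "norm (B x) \<le> opnorm B" if "norm x \<le> 1" for x
    unfolding opnorm_def using that bdd by (intro cSup_upper) auto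
  show "onorm B \<le> opnorm B"
  proof (rule onorm_bound)
    show "0 \<le> opnorm B"
      using *[of 0] by simp
    show "norm (B x) \<le> opnorm B * norm x" for x
    proof (cases "x = 0")
      case False
      then show ?thesis
        using *[of "x /\<^sub>R norm x"] by (simp add: B.scaleR field_simps)
    qed (simp add: B.zero)
  qed
qed

lemma bounded_right_linear_comp:
  "f \<in> bounded_right_linear \<Longrightarrow> g \<in> bounded_right_linear \<Longrightarrow> f \<circ> g \<in> bounded_right_linear"
  by (auto simp: bounded_right_linear_iff o_def intro: bounded_linear_compose)

lemma bounded_right_linear_diff:
  "f \<in> bounded_right_linear \<Longrightarrow> g \<in> bounded_right_linear \<Longrightarrow> (\<lambda>x. f x - g x) \<in> bounded_right_linear"
  by (auto simp: bounded_right_linear_iff rscale_diff_left intro: bounded_linear_sub)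

lemma bounded_right_linear_funpow:
  "f \<in> bounded_right_linear \<Longrightarrow> f ^^ n \<in> bounded_right_linear"
  by (induction n)
    (auto simp: bounded_right_linear_comp,
     auto simp: bounded_right_linear_iff id_def bounded_linear_ident)

lemma bounded_right_linear_rscale_op:
  "B \<in> bounded_right_linear \<Longrightarrow> rscale_op B q \<in> bounded_right_linear"
  by (auto simp: bounded_right_linear_iff rscale_op_def lscale_rscale
      intro: bounded_linear_compose[OF _ bounded_linear_lscale])

lemma bounded_right_linear_lscale_op:
  "B \<in> bounded_right_linear \<Longrightarrow> lscale_op q B \<in> bounded_right_linear"
  by (auto simp: bounded_right_linear_iff lscale_op_def lscale_rscale
      intro: bounded_linear_compose[OF bounded_linear_lscale])

section \<open>Closed right linear operators\<close>

locale closed_right_operator =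
  fixes D :: "'a::banach_quat_bimodule set" and A :: "'a \<Rightarrow> 'a"
  assumes submodule: "right_submodule D"
    and right_linear: "right_linear_on D A"
    and closed: "closed_operator D A"
begin

lemma D_zero: "0 \<in> D"
  and D_add: "x \<in> D \<Longrightarrow> y \<in> D \<Longrightarrow> x + y \<in> D"
  and D_rscale: "x \<in> D \<Longrightarrow> x *\<^sub>r q \<in> D"
  using submodule by (auto simp: right_submodule_def)

lemma D_diff: "x \<in> D \<Longrightarrow> y \<in> D \<Longrightarrow> x - y \<in> D"
  using submodule unfolding right_submodule_def by (metis diff_conv_add_uminus)

lemma D_scaleR: "x \<in> D \<Longrightarrow> r *\<^sub>R x \<in> D"
  using D_rscale[of x "of_real r"] by (simp add: rscale_of_real)

lemmas D_intros = D_zero D_add D_diff D_rscale D_scaleR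

lemma A_add: "x \<in> D \<Longrightarrow> y \<in> D \<Longrightarrow> A (x + y) = A x + A y"
  and A_rscale: "x \<in> D \<Longrightarrow> A (x *\<^sub>r q) = A x *\<^sub>r q"
  using right_linear by (auto simp: right_linear_on_def)

lemma A_diff: "x \<in> D \<Longrightarrow> y \<in> D \<Longrightarrow> A (x - y) = A x - A y"
  using A_add[of "x - y" y] by (simp add: D_diff)

lemma A_zero: "A 0 = 0"
  using A_diff[of 0 0] D_zero by simp

lemma A_scaleR: "x \<in> D \<Longrightarrow> A (r *\<^sub>R x) = r *\<^sub>R A x"
  using A_rscale[of x "of_real r"] by (simp add: rscale_of_real)

lemmas A_simps = A_zero A_add A_diff A_rscale A_scaleR

lemma A_closed:
  assumes "\<And>n. u n \<in> D" "u \<longlonglongrightarrow> x" "(\<lambda>n. A (u n)) \<longlonglongrightarrow> y"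
  shows "x \<in> D \<and> A x = y"
proof -
  have "(\<lambda>n. (u n, A (u n))) \<longlonglongrightarrow> (x, y)"
    by (rule tendsto_Pair[OF assms(2,3)])
  moreover have "(u n, A (u n)) \<in> {(x, A x) | x. x \<in> D}" for n
    using assms(1) by blast
  ultimately have "(x, y) \<in> {(x, A x) | x. x \<in> D}"
    using closed_sequentially[of "{(x, A x) | x. x \<in> D}" "\<lambda>n. (u n, A (u n))"] closed
    unfolding closed_operator_def by blast
  then show ?thesis
    by blast
qed

lemma pow_dom_2: "pow_dom D A 2 = {x \<in> D. A x \<in> D}"
  by (auto simp: numeral_2_eq_2)

lemma Delta_op_eq: "Delta_op A q x = A (A x) - (2 * qRe q) *\<^sub>R A x + (norm q)\<^sup>2 *\<^sub>R x"
  unfolding Delta_op_def lscale_op_def lscale_of_real by (simp add: numeral_2_eq_2)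

text \<open>Right multiplications commute with \<open>A\<close>, so \<open>(A - q') (A - q)\<close> expands into
  \<open>A\<^sup>2 - (q + q') A + q q'\<close>, where \<open>q + q' = 2 Re(q\<^sub>0)\<close> and \<open>q q' = |q\<^sub>0|\<^sup>2 - \<delta>\<close>.\<close>

lemma Delta_op_factor:
  fixes q q\<^sub>0 :: quat
  assumes "x \<in> pow_dom D A 2"
  defines "w \<equiv> A x - x *\<^sub>r q" and "q' \<equiv> of_real (2 * qRe q\<^sub>0) - q"
  shows "Delta_op A q\<^sub>0 x - x *\<^sub>r delta_quat q\<^sub>0 q = A w - w *\<^sub>r q'"
proof -
  have x: "x \<in> D" "A x \<in> D"
    using assms by (auto simp: pow_dom_2)
  have "A w - w *\<^sub>r q' = A (A x) - A x *\<^sub>r q - (A x *\<^sub>r q' - x *\<^sub>r (q * q'))"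
    using x by (simp add: w_def A_simps D_intros rscale_diff_left rscale_rscale)
  also have "A x *\<^sub>r q' = (2 * qRe q\<^sub>0) *\<^sub>R A x - A x *\<^sub>r q"
    unfolding q'_def rscale_diff_right rscale_of_real ..
  also have "x *\<^sub>r (q * q') = (norm q\<^sub>0)\<^sup>2 *\<^sub>R x - x *\<^sub>r delta_quat q\<^sub>0 q"
    unfolding q'_def mult_reflect rscale_diff_right rscale_of_real ..
  finally show ?thesis
    by (simp add: Delta_op_eq)
qed

lemma Delta_op_rscale:
  "x \<in> pow_dom D A 2 \<Longrightarrow> Delta_op A q (x *\<^sub>r p) = Delta_op A q x *\<^sub>r p"
  by (simp add: pow_dom_2 Delta_op_eq A_simps D_intros rscale_add_left rscale_diff_left rscale_scaleR)

context
  fixes q\<^sub>0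
  assumes q\<^sub>0: "q\<^sub>0 \<in> S_resolvent_set D A"
begin

lemma Q_op_mem: "Q_op D A q\<^sub>0 y \<in> pow_dom D A 2"
  and Delta_Q_op: "Delta_op A q\<^sub>0 (Q_op D A q\<^sub>0 y) = y"
  and Q_op_Delta: "x \<in> pow_dom D A 2 \<Longrightarrow> Q_op D A q\<^sub>0 (Delta_op A q\<^sub>0 x) = x"
proof -
  have bij: "bij_betw (Delta_op A q\<^sub>0) (pow_dom D A 2) UNIV"
    using q\<^sub>0 by (simp add: S_resolvent_set_def)
  show "Q_op D A q\<^sub>0 y \<in> pow_dom D A 2"
    using bij unfolding Q_op_def by (metis UNIV_I bij_betw_imp_surj_on inv_into_into)
  show "Delta_op A q\<^sub>0 (Q_op D A q\<^sub>0 y) = y"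
    using bij unfolding Q_op_def by (simp add: bij_betw_inv_into_right)
  show "Q_op D A q\<^sub>0 (Delta_op A q\<^sub>0 x) = x" if "x \<in> pow_dom D A 2"
    using bij that unfolding Q_op_def by (simp add: bij_betw_inv_into_left)
qed

lemma Q_op_D: "Q_op D A q\<^sub>0 y \<in> D" and A_Q_op_D: "A (Q_op D A q\<^sub>0 y) \<in> D"
  using Q_op_mem[of y] by (auto simp: pow_dom_2)

lemma Q_op_bounded_right_linear: "Q_op D A q\<^sub>0 \<in> bounded_right_linear"
  using q\<^sub>0 by (simp add: S_resolvent_set_def)

lemma Q_op_bounded_linear: "bounded_linear (Q_op D A q\<^sub>0)"
  and Q_op_rscale: "Q_op D A q\<^sub>0 (x *\<^sub>r q) = Q_op D A q\<^sub>0 x *\<^sub>r q"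
  using Q_op_bounded_right_linear by (auto simp: bounded_right_linear_iff)

lemma norm_Q_op: "norm (Q_op D A q\<^sub>0 x) \<le> opnorm (Q_op D A q\<^sub>0) * norm x"
  using onorm[OF Q_op_bounded_linear] by (simp add: opnorm_eq_onorm Q_op_bounded_linear)

lemma opnorm_Q_op_nonneg: "0 \<le> opnorm (Q_op D A q\<^sub>0)"
  by (simp add: opnorm_eq_onorm Q_op_bounded_linear onorm_pos_le)

text \<open>A closed operator after a bounded one has a closed graph; here it is defined on all of \<open>X\<close>,
  so the closed graph theorem applies.\<close>

lemma A_Q_op_bounded_right_linear: "A \<circ> Q_op D A q\<^sub>0 \<in> bounded_right_linear"
proof -
  interpret Q: bounded_linear "Q_op D A q\<^sub>0" by (rule Q_op_bounded_linear)
  have "bounded_linear (A \<circ> Q_op D A q\<^sub>0)"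
  proof (rule closed_graph_theorem)
    show "linear (A \<circ> Q_op D A q\<^sub>0)"
      by (rule linearI) (simp_all add: Q.add Q.scaleR A_simps Q_op_D)
    fix u x y assume "u \<longlonglongrightarrow> x" "(\<lambda>n. (A \<circ> Q_op D A q\<^sub>0) (u n)) \<longlonglongrightarrow> y"
    then show "(A \<circ> Q_op D A q\<^sub>0) x = y"
      using A_closed[of "\<lambda>n. Q_op D A q\<^sub>0 (u n)"] by (simp add: Q_op_D Q.tendsto)
  qed
  then show ?thesis
    by (simp add: bounded_right_linear_iff Q_op_rscale A_rscale Q_op_D)
qed

text \<open>For \<open>x\<close> in \<open>D(A)\<close> put \<open>y = Q x\<close>. Solving \<open>\<Delta>\<^bsub>q\<^sub>0\<^esub>(A) y = x\<close> for \<open>A\<^sup>2 y\<close> shows that \<open>A\<^sup>2 y\<close> lies in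
  \<open>D(A)\<close>; so \<open>A\<close> may be applied to the equation, which becomes \<open>\<Delta>\<^bsub>q\<^sub>0\<^esub>(A) (A y) = A x\<close>.\<close>

lemma Q_op_commute:
  assumes "x \<in> D"
  shows "Q_op D A q\<^sub>0 (A x) = A (Q_op D A q\<^sub>0 x)"
proof -
  define y where "y = Q_op D A q\<^sub>0 x"
  have y: "y \<in> D" "A y \<in> D"
    by (simp_all add: y_def Q_op_D A_Q_op_D)
  have x: "A (A y) - (2 * qRe q\<^sub>0) *\<^sub>R A y + (norm q\<^sub>0)\<^sup>2 *\<^sub>R y = x"
    using Delta_Q_op[of x] by (simp add: Delta_op_eq y_def)
  then have "A (A y) = x + (2 * qRe q\<^sub>0) *\<^sub>R A y - (norm q\<^sub>0)\<^sup>2 *\<^sub>R y"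
    by (simp add: algebra_simps)
  then have AAy: "A (A y) \<in> D"
    using assms y by (simp add: D_intros)
  have "Delta_op A q\<^sub>0 (A y) = A x"
    unfolding x[symmetric] using y AAy by (simp add: Delta_op_eq A_simps D_intros)
  then show ?thesis
    using Q_op_Delta[of "A y"] y AAy by (simp add: pow_dom_2 y_def)
qed

lemma funpow_Q_op_commute:
  "(Q_op D A q\<^sub>0 ^^ k) (A (Q_op D A q\<^sub>0 x)) = A (Q_op D A q\<^sub>0 ((Q_op D A q\<^sub>0 ^^ k) x))"
  by (induction k) (simp_all add: Q_op_commute Q_op_D)

section \<open>The resolvent set near one of its points\<close>

text \<open>The commuting factors of the bijection \<open>x \<mapsto> \<Delta>\<^bsub>q\<^sub>0\<^esub>(A) x - x \<delta>\<close> are bijections. Written with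
  \<open>A - q\<close> on the left, the product gives surjectivity of \<open>A - q\<close>; with \<open>A - q\<close> on the right, it
  gives injectivity.\<close>

lemma shift_bij:
  assumes q: "opnorm (Q_op D A q\<^sub>0) * norm (delta_quat q\<^sub>0 q) < 1"
  shows "bij_betw (\<lambda>x. A x - x *\<^sub>r q) D UNIV"
proof -
  define q' where "q' = of_real (2 * qRe q\<^sub>0) - q"
  define d where "d = delta_quat q\<^sub>0 q"
  define c where "c = opnorm (Q_op D A q\<^sub>0) * norm d"
  have c: "0 \<le> c" "c < 1"
    using q opnorm_Q_op_nonneg by (simp_all add: c_def d_def)
  interpret Q: bounded_linear "Q_op D A q\<^sub>0" by (rule Q_op_bounded_linear)
  have norm_le: "norm (Q_op D A q\<^sub>0 (x *\<^sub>r d)) \<le> c * norm x" for x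
    using norm_Q_op[of "x *\<^sub>r d"] by (simp add: norm_rscale c_def)
  have surj: "\<exists>x\<in>D. A x - x *\<^sub>r q = y" for y
  proof -
    have "dist (Q_op D A q\<^sub>0 (y + x *\<^sub>r d)) (Q_op D A q\<^sub>0 (y + z *\<^sub>r d)) \<le> c * dist x z" for x z
      using norm_le[of "x - z"] by (simp add: dist_norm Q.diff Q.add rscale_diff_left)
    then obtain x where x: "Q_op D A q\<^sub>0 (y + x *\<^sub>r d) = x"
      using banach_fix_type[OF c, of "\<lambda>x. Q_op D A q\<^sub>0 (y + x *\<^sub>r d)"] by blast
    have mem: "x \<in> pow_dom D A 2" and "Delta_op A q\<^sub>0 x = y + x *\<^sub>r d"
      using Q_op_mem Delta_Q_op x by metis+
    moreover have "of_real (2 * qRe q\<^sub>0) - q' = q"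
      by (simp add: q'_def)
    ultimately have "A (A x - x *\<^sub>r q') - (A x - x *\<^sub>r q') *\<^sub>r q = y"
      using Delta_op_factor[of x q\<^sub>0 q'] delta_quat_reflect[of q\<^sub>0 q]
      by (simp add: q'_def d_def del: of_real_mult)
    then show ?thesis
      using mem by (auto simp: pow_dom_2 intro!: bexI[of _ "A x - x *\<^sub>r q'"] D_intros)
  qed
  have kernel: "x = 0" if "x \<in> D" "A x - x *\<^sub>r q = 0" for x
  proof -
    \<comment> \<open>an eigenvector of \<open>A\<close> is in \<open>D(A\<^sup>2)\<close>, because its image is a multiple of it\<close>
    have "A x = x *\<^sub>r q"
      using that by simp
    then have mem: "x \<in> pow_dom D A 2"
      using that by (simp add: pow_dom_2 D_intros)
    then have "Delta_op A q\<^sub>0 x = x *\<^sub>r d"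
      using Delta_op_factor[of x q\<^sub>0 q] that A_zero by (simp add: d_def)
    then have "x = Q_op D A q\<^sub>0 (x *\<^sub>r d)"
      using Q_op_Delta[OF mem] by simp
    then have "norm x \<le> c * norm x"
      using norm_le[of x] by simp
    then show "x = 0"
      using c by (metis linorder_not_less mult_less_cancel_right2 norm_eq_zero norm_not_less_zero not_less_iff_gr_or_eq)
  qed
  have "inj_on (\<lambda>x. A x - x *\<^sub>r q) D"
  proof (rule inj_onI)
    fix x y assume "x \<in> D" "y \<in> D" "A x - x *\<^sub>r q = A y - y *\<^sub>r q"
    then show "x = y"
      using kernel[of "x - y"] by (simp add: A_simps D_intros rscale_diff_left algebra_simps)
  qed
  moreover have "(\<lambda>x. A x - x *\<^sub>r q) ` D = UNIV"
    using surj by (auto simp: image_iff) metis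
  ultimately show ?thesis
    by (simp add: bij_betw_def)
qed

end

lemma shift_inverse:
  assumes bij: "bij_betw (\<lambda>x. A x - x *\<^sub>r q) D UNIV"
  obtains G where "bounded_linear G" "\<And>y. G y \<in> D" "\<And>y. A (G y) - G y *\<^sub>r q = y"
proof -
  define G where "G = inv_into D (\<lambda>x. A x - x *\<^sub>r q)"
  have GD: "G y \<in> D" for y
    using bij unfolding G_def by (metis UNIV_I bij_betw_imp_surj_on inv_into_into)
  have AG: "A (G y) - G y *\<^sub>r q = y" for y
    using bij_betw_inv_into_right[OF bij, of y] by (simp add: G_def)
  have GI: "G y = x" if "x \<in> D" "A x - x *\<^sub>r q = y" for x y
    using bij_betw_inv_into_left[OF bij, of x] that by (simp add: G_def)
  have "bounded_linear G"
  proof (rule closed_graph_theorem)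
    show "linear G"
    proof (rule linearI)
      show "G (x + y) = G x + G y" for x y
        using AG[of x] AG[of y]
        by (intro GI) (simp_all add: GD D_intros A_simps rscale_add_left algebra_simps)
      show "G (r *\<^sub>R x) = r *\<^sub>R G x" for r x
        using AG[of x]
        by (intro GI) (simp_all add: GD D_intros A_simps rscale_scaleR flip: scaleR_right_diff_distrib)
    qed
    fix u y x assume u: "u \<longlonglongrightarrow> y" "(\<lambda>n. G (u n)) \<longlonglongrightarrow> x"
    have "(\<lambda>n. A (G (u n))) = (\<lambda>n. u n + G (u n) *\<^sub>r q)"
      using AG by (metis diff_add_cancel)
    then have "(\<lambda>n. A (G (u n))) \<longlonglongrightarrow> y + x *\<^sub>r q"
      using u by (auto intro!: tendsto_add bounded_linear.tendsto[OF bounded_linear_rscale])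
    then have "x \<in> D" "A x = y + x *\<^sub>r q"
      using A_closed[of "\<lambda>n. G (u n)"] u GD by blast+
    then show "G y = x"
      by (intro GI) simp_all
  qed
  then show thesis
    using that GD AG by blast
qed

text \<open>The inverse of \<open>\<Delta>\<^sub>q(A)\<close> is the product of the inverses of its two linear factors.\<close>

lemma S_resolvent_setI:
  assumes q: "bij_betw (\<lambda>x. A x - x *\<^sub>r q) D UNIV"
    and qc: "bij_betw (\<lambda>x. A x - x *\<^sub>r qcnj q) D UNIV"
  shows "q \<in> S_resolvent_set D A"
proof -
  obtain G where G: "bounded_linear G" "\<And>y. G y \<in> D" "\<And>y. A (G y) - G y *\<^sub>r q = y"
    using shift_inverse[OF q] by blast
  obtain G' where G': "bounded_linear G'" "\<And>y. G' y \<in> D" "\<And>y. A (G' y) - G' y *\<^sub>r qcnj q = y"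
    using shift_inverse[OF qc] by blast
  define w where "w x = A x - x *\<^sub>r q" for x
  have "qcnj q = of_real (2 * qRe q) - q"
    using add_qcnj[of q] by (metis add_diff_cancel_left')
  then have Delta: "Delta_op A q x = A (w x) - w x *\<^sub>r qcnj q" if "x \<in> pow_dom D A 2" for x
    using Delta_op_factor[OF that, of q q] by (simp add: w_def del: of_real_mult)
  have wD: "w x \<in> D" if "x \<in> pow_dom D A 2" for x
    using that by (simp add: w_def pow_dom_2 D_intros)
  have mem: "G (G' y) \<in> pow_dom D A 2" for y
  proof -
    have "A (G (G' y)) = G' y + G (G' y) *\<^sub>r q"
      using G(3)[of "G' y"] by (metis diff_add_cancel)
    then show ?thesis
      using G(2) G'(2) by (simp add: pow_dom_2 D_intros)
  qed
  have right: "Delta_op A q (G (G' y)) = y" for y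
    using Delta[OF mem] G(3) G'(3) by (simp add: w_def)
  have inj: "inj_on (Delta_op A q) (pow_dom D A 2)"
  proof (rule inj_onI)
    fix x y assume xy: "x \<in> pow_dom D A 2" "y \<in> pow_dom D A 2" "Delta_op A q x = Delta_op A q y"
    then have "w x = w y"
      using bij_betw_imp_inj_on[OF qc] wD Delta by (auto dest!: inj_onD)
    then show "x = y"
      using bij_betw_imp_inj_on[OF q] xy by (auto simp: w_def pow_dom_2 dest!: inj_onD)
  qed
  have bij: "bij_betw (Delta_op A q) (pow_dom D A 2) UNIV"
    using inj right mem unfolding bij_betw_def by (metis UNIV_eq_I image_eqI)
  have Q: "Q_op D A q = (\<lambda>y. G (G' y))"
    unfolding Q_op_def using inv_into_f_eq[OF inj mem right] by blast
  have "G (G' (y *\<^sub>r p)) = G (G' y) *\<^sub>r p" for y p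
  proof (rule inj_onD[OF inj])
    show "G (G' y) *\<^sub>r p \<in> pow_dom D A 2"
      using mem[of y] by (simp add: pow_dom_2 A_simps D_intros)
  qed (simp_all add: mem right Delta_op_rscale)
  then have "Q_op D A q \<in> bounded_right_linear"
    using bounded_linear_compose[OF G(1) G'(1)] by (simp add: Q bounded_right_linear_iff)
  then show ?thesis
    using bij by (simp add: S_resolvent_set_def)
qed

lemma S_resolvent_set_near:
  assumes "q\<^sub>0 \<in> S_resolvent_set D A"
    and "opnorm (Q_op D A q\<^sub>0) * norm (delta_quat q\<^sub>0 q) < 1"
  shows "q \<in> S_resolvent_set D A"
  using assms by (intro S_resolvent_setI; intro shift_bij[of q\<^sub>0]) (simp_all add: delta_quat_qcnj)

section \<open>The equation of the S-resolvent operator\<close>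

lemma S_resolvent_op_bounded_right_linear:
  assumes "q\<^sub>0 \<in> S_resolvent_set D A"
  shows "S_resolvent_op D A q\<^sub>0 \<in> bounded_right_linear"
proof -
  have "S_resolvent_op D A q\<^sub>0 =
      (\<lambda>x. rscale_op (Q_op D A q\<^sub>0) (qcnj q\<^sub>0) x - (A \<circ> Q_op D A q\<^sub>0) x)"
    by (simp add: fun_eq_iff S_resolvent_op_def)
  then show ?thesis
    using bounded_right_linear_diff[OF
        bounded_right_linear_rscale_op[OF Q_op_bounded_right_linear[OF assms]]
        A_Q_op_bounded_right_linear[OF assms]]
    by simp
qed

lemma B_op_bounded_right_linear:
  assumes "q\<^sub>0 \<in> S_resolvent_set D A"
  shows "B_op D A q\<^sub>0 n \<in> bounded_right_linear"
  using bounded_right_linear_funpow[OF Q_op_bounded_right_linear[OF assms]]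
    S_resolvent_op_bounded_right_linear[OF assms]
  by (simp add: B_op_def bounded_right_linear_comp)

text \<open>Here \<open>q\<close>, \<open>q'\<close> and \<open>\<delta>\<close> multiply the argument of \<open>W\<close>, whereas \<open>A\<close> acts on its value. So
  both actions on \<open>W\<close> commute although \<open>A\<close> is not left linear, and again
  \<open>(A - q) (A - q') = \<Delta>\<^bsub>q\<^sub>0\<^esub>(A) - \<delta>\<close>: the hypothesis says that this product sends \<open>W\<close> to the
  identity, \<open>T\<close> is the negative of the image of \<open>W\<close> under \<open>A - q'\<close>, and the conclusion applies
  \<open>A - q\<close>. The lemma serves for the sum of the series, and with \<open>q\<^sub>0 = q\<close>, \<open>\<delta> = 0\<close> for the
  S-resolvent operator itself.\<close>

lemma S_equation:
  fixes q q\<^sub>0 :: quat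
  assumes "linear W" and W_mem: "\<And>x. W x \<in> pow_dom D A 2"
    and W: "\<And>x. Delta_op A q\<^sub>0 (W x) - W (delta_quat q\<^sub>0 q *\<^sub>l x) = x"
  defines "T \<equiv> \<lambda>x. W ((of_real (2 * qRe q\<^sub>0) - q) *\<^sub>l x) - A (W x)"
  shows "T x \<in> D" and "T (q *\<^sub>l x) - A (T x) = x"
proof -
  interpret W: linear W by fact
  have D: "W x \<in> D" "A (W x) \<in> D" for x
    using W_mem[of x] by (auto simp: pow_dom_2)
  show "T x \<in> D"
    by (simp add: T_def D D_intros del: of_real_mult)
  have "T (q *\<^sub>l x) = (norm q\<^sub>0)\<^sup>2 *\<^sub>R W x - W (delta_quat q\<^sub>0 q *\<^sub>l x) - A (W (q *\<^sub>l x))"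
    unfolding T_def lscale_lscale mult_reflect
    unfolding lscale_diff_left lscale_of_real W.diff W.scaleR ..
  moreover have "A (T x) = (2 * qRe q\<^sub>0) *\<^sub>R A (W x) - A (W (q *\<^sub>l x)) - A (A (W x))"
    unfolding T_def lscale_diff_left lscale_of_real W.diff W.scaleR
    by (simp add: D D_intros A_simps)
  ultimately have "T (q *\<^sub>l x) - A (T x) = Delta_op A q\<^sub>0 (W x) - W (delta_quat q\<^sub>0 q *\<^sub>l x)"
    by (simp only: Delta_op_eq) (simp only: algebra_simps)
  then show "T (q *\<^sub>l x) - A (T x) = x"
    using W[of x] by simp
qed

text \<open>Such a \<open>Y\<close> turns left multiplication by \<open>q\<close> into \<open>A\<close>, hence left multiplication by
  \<open>\<triangle>\<^sub>q(q) = 0\<close> into \<open>\<Delta>\<^sub>q(A)\<close>, which is injective.\<close>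

lemma S_equation_unique:
  fixes Y :: "'a \<Rightarrow> 'a"
  assumes q: "q \<in> S_resolvent_set D A"
    and "linear Y" and Y_mem: "\<And>x. Y x \<in> D" and Y: "\<And>x. Y (q *\<^sub>l x) = A (Y x)"
  shows "Y x = 0"
proof -
  interpret Y: linear Y by fact
  have mem: "Y x \<in> pow_dom D A 2"
    using Y_mem by (simp add: pow_dom_2 flip: Y)
  have "Delta_op A q (Y x) = Y (delta_quat q q *\<^sub>l x)"
    unfolding delta_quat_def lscale_add_left lscale_diff_left lscale_lscale[symmetric]
      lscale_of_real Y.add Y.diff Y.scaleR power2_eq_square[of q] Y Delta_op_eq ..
  then have "Delta_op A q (Y x) = Delta_op A q 0"
    by (simp add: Y.zero Delta_op_eq A_zero)
  moreover have "0 \<in> pow_dom D A 2"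
    by (simp add: pow_dom_2 A_zero D_zero)
  ultimately show ?thesis
    using Q_op_Delta[OF q] mem by metis
qed

lemma S_resolvent_op_equation:
  assumes "q \<in> S_resolvent_set D A"
  shows "S_resolvent_op D A q x \<in> D"
    and "S_resolvent_op D A q (q *\<^sub>l x) - A (S_resolvent_op D A q x) = x"
proof -
  have *: "of_real (2 * qRe q) - q = qcnj q"
    using add_qcnj[of q] by (metis add_diff_cancel_left')
  have "linear (Q_op D A q)"
    using Q_op_bounded_linear[OF assms] by (rule bounded_linear.linear)
  note ** = this S_equation[OF this Q_op_mem[OF assms], of q q x]
  show "S_resolvent_op D A q x \<in> D"
    "S_resolvent_op D A q (q *\<^sub>l x) - A (S_resolvent_op D A q x) = x"
    using **(2,3) linear_0[OF **(1)]
    by (simp_all only: * S_resolvent_op_def rscale_op_def o_apply delta_quat_self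
        lscale_zero_left Delta_Q_op[OF assms] diff_zero)
qed

section \<open>The spherical series\<close>

context
  fixes q\<^sub>0 q
  assumes q\<^sub>0: "q\<^sub>0 \<in> S_resolvent_set D A"
    and less: "opnorm (Q_op D A q\<^sub>0) * norm (delta_quat q\<^sub>0 q) < 1"
begin

private abbreviation "Q \<equiv> Q_op D A q\<^sub>0"
private abbreviation "d \<equiv> delta_quat q\<^sub>0 q"
private abbreviation "\<theta> \<equiv> opnorm Q * norm d"

interpretation Q: bounded_linear Q
  by (rule Q_op_bounded_linear[OF q\<^sub>0])

lemma theta_nonneg: "0 \<le> \<theta>"
  using opnorm_Q_op_nonneg[OF q\<^sub>0] by simp

lemma funpow_Q_bounded_linear: "bounded_linear (Q ^^ k)"
  using bounded_right_linear_funpow[OF Q_op_bounded_right_linear[OF q\<^sub>0]]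
  by (simp add: bounded_right_linear_iff)

lemma norm_funpow_Q: "norm ((Q ^^ k) x) \<le> opnorm Q ^ k * norm x"
proof (induction k)
  case (Suc k)
  show ?case
    using order.trans[OF norm_Q_op[OF q\<^sub>0] mult_left_mono[OF Suc opnorm_Q_op_nonneg[OF q\<^sub>0]]]
    by (simp add: mult_ac)
qed simp

lemma norm_funpow_Q_delta:
  fixes L :: "'a \<Rightarrow> 'a"
  assumes "\<And>x. norm (L x) \<le> C * norm x"
  shows "norm ((Q ^^ k) (L (d ^ k *\<^sub>l x))) \<le> C * \<theta> ^ k * norm x"
proof -
  have "norm ((Q ^^ k) (L (d ^ k *\<^sub>l x))) \<le> opnorm Q ^ k * (C * norm (d ^ k *\<^sub>l x))"
    using norm_funpow_Q opnorm_Q_op_nonneg[OF q\<^sub>0] assms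
    by (meson mult_left_mono order.trans zero_le_power)
  then show ?thesis
    by (simp add: norm_lscale norm_power power_mult_distrib mult_ac)
qed

text \<open>This is not the sum of the powers of the operator \<open>x \<mapsto> Q(\<delta> x)\<close>, since \<open>Q\<close> need not commute
  with left multiplications. It is the geometric series of the map \<open>V \<mapsto> (x \<mapsto> Q(V(\<delta> x)))\<close> on
  operators, applied to the identity.\<close>

definition neumann :: "'a \<Rightarrow> 'a" where
  "neumann x = (\<Sum>k. (Q ^^ k) (d ^ k *\<^sub>l x))"

lemma neumann_sums: "(\<lambda>k. (Q ^^ k) (d ^ k *\<^sub>l x)) sums neumann x"
proof -
  have "summable (\<lambda>k. \<theta> ^ k * norm x)"
    using theta_nonneg less by (intro summable_mult2 summable_geometric) simp
  then have "summable (\<lambda>k. (Q ^^ k) (d ^ k *\<^sub>l x))"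
    by (rule summable_comparison_test') (use norm_funpow_Q_delta[of "\<lambda>x. x" 1] in simp)
  then show ?thesis
    by (simp add: neumann_def summable_sums)
qed

lemma linear_neumann: "linear neumann"
proof (rule linearI)
  note lin = bounded_linear.linear[OF funpow_Q_bounded_linear]
  show "neumann (x + y) = neumann x + neumann y" for x y
    using sums_add[OF neumann_sums[of x] neumann_sums[of y]] neumann_sums[of "x + y"]
    by (simp add: lscale_add_right linear_add[OF lin] sums_unique2)
  show "neumann (r *\<^sub>R x) = r *\<^sub>R neumann x" for r x
    using sums_scaleR_right[OF neumann_sums[of x], of r] neumann_sums[of "r *\<^sub>R x"]
    by (simp add: lscale_scaleR linear_scale[OF lin] sums_unique2)
qed

lemma neumann_eq: "neumann x = x + Q (neumann (d *\<^sub>l x))"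
proof -
  have "(\<lambda>k. (Q ^^ Suc k) (d ^ Suc k *\<^sub>l x)) sums Q (neumann (d *\<^sub>l x))"
    using Q.sums[OF neumann_sums[of "d *\<^sub>l x"]]
    by (simp add: lscale_lscale power_commutes)
  then have "(\<lambda>k. (Q ^^ k) (d ^ k *\<^sub>l x)) sums (Q (neumann (d *\<^sub>l x)) + x)"
    using sums_Suc_iff[of "\<lambda>k. (Q ^^ k) (d ^ k *\<^sub>l x)"] by (simp add: lscale_one)
  then show ?thesis
    using neumann_sums[of x] sums_unique2 by (metis add.commute)
qed

text \<open>By \<open>neumann_eq\<close> the operator \<open>x \<mapsto> Q (neumann x)\<close> is a \<open>W\<close> as in \<open>S_equation\<close>; so both
  sides solve the equation there, which has only one solution.\<close>

lemma S_resolvent_op_neumann: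
  "S_resolvent_op D A q x =
    Q (neumann ((of_real (2 * qRe q\<^sub>0) - q) *\<^sub>l x)) - A (Q (neumann x))"
proof -
  define T where "T x =
    Q (neumann ((of_real (2 * qRe q\<^sub>0) - q) *\<^sub>l x)) - A (Q (neumann x))" for x
  have q: "q \<in> S_resolvent_set D A"
    using q\<^sub>0 less by (rule S_resolvent_set_near)
  have lin: "linear (\<lambda>x. Q (neumann x))"
    using linear_compose[OF linear_neumann Q.linear] by (simp add: o_def)
  have "Delta_op A q\<^sub>0 (Q (neumann x)) - Q (neumann (d *\<^sub>l x)) = x" for x
    using neumann_eq[of x] by (simp add: Delta_Q_op[OF q\<^sub>0])
  note T = S_equation[OF lin Q_op_mem[OF q\<^sub>0] this, folded T_def]
  have "bounded_linear (A \<circ> Q)"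
    using A_Q_op_bounded_right_linear[OF q\<^sub>0] by (simp add: bounded_right_linear_iff)
  then have "linear ((A \<circ> Q) \<circ> neumann)"
    using linear_compose[OF linear_neumann bounded_linear.linear] by blast
  moreover have "linear (\<lambda>x. Q (neumann ((of_real (2 * qRe q\<^sub>0) - q) *\<^sub>l x)))"
    using linear_compose[OF bounded_linear.linear[OF bounded_linear_lscale] lin] by (simp add: o_def)
  ultimately have lin_T: "linear T"
    unfolding T_def by (intro linear_compose_sub) (simp_all add: o_def)
  have "linear (S_resolvent_op D A q)"
    using S_resolvent_op_bounded_right_linear[OF q]
    by (simp add: bounded_right_linear_iff bounded_linear.linear)
  then have "linear (\<lambda>x. S_resolvent_op D A q x - T x)"
    using lin_T by (rule linear_compose_sub)
  moreover have "S_resolvent_op D A q (q *\<^sub>l x) - T (q *\<^sub>l x) = A (S_resolvent_op D A q x - T x)" for x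
    using S_resolvent_op_equation[OF q, of x] T[of x] by (simp add: A_diff algebra_simps)
  ultimately have "S_resolvent_op D A q x - T x = 0"
    using S_resolvent_op_equation(1)[OF q] T(1)
    by (intro S_equation_unique[OF q, of "\<lambda>x. S_resolvent_op D A q x - T x"]) (simp_all add: D_diff)
  then show ?thesis
    by (simp add: T_def)
qed

private abbreviation "F \<equiv> \<lambda>n. lscale_op ((-1) ^ n) (rscale_op (B_op D A q\<^sub>0 (n + 1)) (p_fun q\<^sub>0 n q))"

lemma series_term_even: "F (2 * k) x = (Q ^^ k) (S_resolvent_op D A q\<^sub>0 (d ^ k *\<^sub>l x))"
  by (simp add: lscale_op_def rscale_op_def B_op_def p_fun_def lscale_one)

lemma series_term_odd: "F (2 * k + 1) x = - (Q ^^ k) (Q ((q - q\<^sub>0) *\<^sub>l (d ^ k *\<^sub>l x)))"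
  using lscale_of_real[of "-1"]
  by (simp add: lscale_op_def rscale_op_def B_op_def p_fun_def lscale_lscale funpow_swap1)

text \<open>Both terms of the pair have the form \<open>Q\<^sup>k\<close> applied to an operator at \<open>z = \<delta>\<^sup>k x\<close>. The
  multipliers inside \<open>Q\<close>, the conjugate of \<open>q\<^sub>0\<close> and \<open>q - q\<^sub>0\<close>, combine to \<open>q'\<close>, and \<open>A\<close> moves to the
  left because \<open>A Q\<close> commutes with \<open>Q\<close>.\<close>

lemma series_term_pair:
  "F (2 * k) x + F (2 * k + 1) x =
    Q ((Q ^^ k) (d ^ k *\<^sub>l ((of_real (2 * qRe q\<^sub>0) - q) *\<^sub>l x))) - A (Q ((Q ^^ k) (d ^ k *\<^sub>l x)))"
proof -
  define z where "z = d ^ k *\<^sub>l x"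
  note lin = bounded_linear.linear[OF funpow_Q_bounded_linear]
  have "F (2 * k) x + F (2 * k + 1) x =
      (Q ^^ k) (Q (qcnj q\<^sub>0 *\<^sub>l z) - A (Q z)) - (Q ^^ k) (Q ((q - q\<^sub>0) *\<^sub>l z))"
    unfolding series_term_even series_term_odd
    by (simp add: S_resolvent_op_def rscale_op_def z_def)
  also have "\<dots> = (Q ^^ k) (Q (qcnj q\<^sub>0 *\<^sub>l z - (q - q\<^sub>0) *\<^sub>l z)) - (Q ^^ k) (A (Q z))"
    by (simp add: linear_diff[OF lin] Q.diff)
  also have "qcnj q\<^sub>0 *\<^sub>l z - (q - q\<^sub>0) *\<^sub>l z = (q\<^sub>0 + qcnj q\<^sub>0 - q) *\<^sub>l z"
    by (simp add: algebra_simps flip: lscale_diff_left)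
  also have "\<dots> = d ^ k *\<^sub>l ((of_real (2 * qRe q\<^sub>0) - q) *\<^sub>l x)"
    unfolding add_qcnj z_def lscale_lscale
    by (simp only: power_commuting_commutes[OF delta_quat_commute_reflect])
  finally show ?thesis
    by (simp only: funpow_Q_op_commute[OF q\<^sub>0] z_def funpow_swap1)
qed

lemma series_term_bounded_right_linear: "F n \<in> bounded_right_linear"
  by (intro bounded_right_linear_lscale_op bounded_right_linear_rscale_op
      B_op_bounded_right_linear q\<^sub>0)

lemma norm_series_term: "\<exists>C\<ge>0. \<forall>n x. norm (F n x) \<le> C * \<theta> ^ (n div 2) * norm x"
proof -
  define a where "a = opnorm (S_resolvent_op D A q\<^sub>0)"
  define b where "b = opnorm Q * norm (q - q\<^sub>0)"
  have bl: "bounded_linear (S_resolvent_op D A q\<^sub>0)"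
    using S_resolvent_op_bounded_right_linear[OF q\<^sub>0] by (simp add: bounded_right_linear_iff)
  have a: "norm (S_resolvent_op D A q\<^sub>0 x) \<le> a * norm x" "0 \<le> a" for x
    using onorm[OF bl] onorm_pos_le[OF bl] by (simp_all add: a_def opnorm_eq_onorm[OF bl])
  have b: "norm (Q ((q - q\<^sub>0) *\<^sub>l x)) \<le> b * norm x" "0 \<le> b" for x
    using norm_Q_op[OF q\<^sub>0, of "(q - q\<^sub>0) *\<^sub>l x"] opnorm_Q_op_nonneg[OF q\<^sub>0]
    by (simp_all add: b_def norm_lscale)
  have "norm (F n x) \<le> (a + b) * \<theta> ^ (n div 2) * norm x" for n x
  proof (cases "even n")
    case True
    then obtain k where n: "n = 2 * k" by blast
    have "norm (F n x) \<le> a * \<theta> ^ k * norm x"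
      using norm_funpow_Q_delta[OF a(1)] unfolding n series_term_even .
    also have "\<dots> \<le> (a + b) * \<theta> ^ k * norm x"
      using b(2) theta_nonneg by (intro mult_right_mono) auto
    finally show ?thesis by (simp add: n)
  next
    case False
    then obtain k where n: "n = 2 * k + 1" using oddE by blast
    have "norm (F n x) \<le> b * \<theta> ^ k * norm x"
      using norm_funpow_Q_delta[OF b(1)] unfolding n series_term_odd norm_minus_cancel .
    also have "\<dots> \<le> (a + b) * \<theta> ^ k * norm x"
      using a(2) theta_nonneg by (intro mult_right_mono) auto
    finally show ?thesis by (simp add: n)
  qed
  then show ?thesis
    using a(2) b(2) by (intro exI[of _ "a + b"]) simp
qed

lemma summable_power_div_2: "summable (\<lambda>n. \<theta> ^ (n div 2))"
proof (rule summableI_nonneg_bounded)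
  show "0 \<le> \<theta> ^ (n div 2)" for n
    using theta_nonneg by simp
  have 1: "(\<Sum>n<2 * N. \<theta> ^ (n div 2)) = 2 * (\<Sum>k<N. \<theta> ^ k)" for N
    by (induction N) simp_all
  have 2: "(\<Sum>k<N. \<theta> ^ k) \<le> (\<Sum>k. \<theta> ^ k)" for N
    using theta_nonneg less by (intro sum_le_suminf summable_geometric) auto
  have 3: "(\<Sum>n<N. \<theta> ^ (n div 2)) \<le> (\<Sum>n<2 * N. \<theta> ^ (n div 2))" for N
    using theta_nonneg by (intro sum_mono2) auto
  show "(\<Sum>n<N. \<theta> ^ (n div 2)) \<le> 2 * (\<Sum>k. \<theta> ^ k)" for N
    using 3[of N] 2[of N] unfolding 1 by linarith
qed

text \<open>The bound on the terms gives convergence in the Banach space of bounded real linear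
  operators. The sum is then identified pointwise, by grouping the terms in pairs.\<close>

lemma S_resolvent_op_series: "op_sums F (S_resolvent_op D A q)"
proof -
  define f where "f n = Blinfun (F n)" for n
  have f: "blinfun_apply (f n) = F n" for n
    using series_term_bounded_right_linear[of n]
    by (simp add: f_def bounded_right_linear_iff bounded_linear_Blinfun_apply)
  obtain C where C: "C \<ge> 0" "\<And>n x. norm (F n x) \<le> C * \<theta> ^ (n div 2) * norm x"
    using norm_series_term by blast
  have "norm (f n) \<le> C * \<theta> ^ (n div 2)" for n
    using C theta_nonneg by (intro norm_blinfun_bound) (simp_all only: f mult_nonneg_nonneg zero_le_power)
  then have summable: "summable f"
    by (intro summable_comparison_test'[OF summable_mult[OF summable_power_div_2]])
  define s where "s = suminf f"
  have "blinfun_apply s x = S_resolvent_op D A q x" for x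
  proof -
    have "(\<lambda>n. F n x) sums blinfun_apply s x"
      using bounded_linear.sums[OF blinfun.bounded_linear_left summable_sums[OF summable], of x]
      by (simp only: f s_def)
    then have "(\<lambda>k. \<Sum>n\<in>{k * 2..<k * 2 + 2}. F n x) sums blinfun_apply s x"
      by (rule sums_group) simp
    moreover have "(\<Sum>n\<in>{k * 2..<k * 2 + 2}. F n x) = F (2 * k) x + F (2 * k + 1) x" for k
    proof -
      have "{k * 2..<k * 2 + 2} = {2 * k, 2 * k + 1}"
        by auto
      then show ?thesis
        by simp
    qed
    ultimately have "(\<lambda>k. F (2 * k) x + F (2 * k + 1) x) sums blinfun_apply s x"
      by simp
    moreover have "bounded_linear (A \<circ> Q)"
      using A_Q_op_bounded_right_linear[OF q\<^sub>0] by (simp add: bounded_right_linear_iff)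
    then have "(\<lambda>k. A (Q ((Q ^^ k) (d ^ k *\<^sub>l x)))) sums A (Q (neumann x))"
      using bounded_linear.sums neumann_sums by fastforce
    then have "(\<lambda>k. F (2 * k) x + F (2 * k + 1) x) sums S_resolvent_op D A q x"
      unfolding series_term_pair S_resolvent_op_neumann
      by (intro sums_diff Q.sums neumann_sums)
    ultimately show ?thesis
      by (rule sums_unique2)
  qed
  then have s: "blinfun_apply s = S_resolvent_op D A q"
    by blast
  have "opnorm (\<lambda>x. (\<Sum>n<N. F n x) - S_resolvent_op D A q x) = norm ((\<Sum>n<N. f n) - s)" for N
  proof -
    have "(\<lambda>x. (\<Sum>n<N. F n x) - S_resolvent_op D A q x) = blinfun_apply ((\<Sum>n<N. f n) - s)"
      by (simp add: fun_eq_iff blinfun.diff_left blinfun.sum_left f s)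
    then show ?thesis
      by (simp only: opnorm_eq_onorm[OF blinfun.bounded_linear_right] norm_blinfun.rep_eq)
  qed
  moreover have "(\<lambda>N. norm ((\<Sum>n<N. f n) - s)) \<longlonglongrightarrow> 0"
    using summable_LIMSEQ[OF summable] by (simp only: s_def LIM_zero_iff tendsto_norm_zero_iff)
  ultimately show ?thesis
    using series_term_bounded_right_linear
      S_resolvent_op_bounded_right_linear[OF S_resolvent_set_near[OF q\<^sub>0 less]]
    by (simp add: op_sums_def)
qed

end

end

section \<open>Cassini balls\<close>

lemma inv_sqrt_pos: "0 < inv_sqrt t"
  by (simp add: inv_sqrt_def)

lemma mem_cassini_ball_iff:
  assumes "0 \<le> t"
  shows "q \<in> cassini_ball q\<^sub>0 (inv_sqrt t) \<longleftrightarrow> t * norm (delta_quat q\<^sub>0 q) < 1"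
proof (cases "t = 0")
  case False
  let ?n = "norm (delta_quat q\<^sub>0 q)"
  have t: "t > 0"
    using False assms by simp
  have "t powr (-1/2) = 1 / sqrt t"
    using powr_minus[of t "1/2"] t by (simp add: powr_half_sqrt inverse_eq_divide)
  then have "q \<in> cassini_ball q\<^sub>0 (inv_sqrt t) \<longleftrightarrow> sqrt ?n < 1 / sqrt t"
    using False by (simp add: cassini_ball_def cassini_def inv_sqrt_def)
  also have "\<dots> \<longleftrightarrow> sqrt ?n * sqrt t < 1"
    using t by (intro pos_less_divide_eq) simp
  also have "\<dots> \<longleftrightarrow> t * ?n < 1"
    by (simp add: mult.commute flip: real_sqrt_mult)
  finally show ?thesis .
qed (simp add: cassini_ball_def inv_sqrt_def)

lemma openin_cassini_topologyI:
  assumes "\<And>p. p \<in> V \<Longrightarrow> \<exists>t\<ge>0. \<forall>q. t * norm (delta_quat p q) < 1 \<longrightarrow> q \<in> V"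
  shows "openin cassini_topology V"
  unfolding openin_cassini_topology
proof
  fix p assume "p \<in> V"
  then obtain t where t: "t \<ge> 0" "\<And>q. t * norm (delta_quat p q) < 1 \<Longrightarrow> q \<in> V"
    using assms by blast
  \<comment> \<open>\<open>inv_sqrt t\<close> may be infinite, but a finite radius is asked for\<close>
  obtain r where r: "0 < ereal r" "ereal r \<le> inv_sqrt t"
    using inv_sqrt_pos[of t] ereal_dense2 less_imp_le by blast
  then have "cassini_ball p (ereal r) \<subseteq> V"
    using t(2) mem_cassini_ball_iff[OF t(1), of _ p] less_le_trans[OF _ r(2)]
    unfolding cassini_ball_def by blast
  then show "\<exists>r>0. cassini_ball p (ereal r) \<subseteq> V"
    using r(1) by auto
qed

lemma open_if_openin_cassini_topology:
  assumes "openin cassini_topology V"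
  shows "open V"
  unfolding open_subopen[of V]
proof
  fix p assume "p \<in> V"
  then obtain r where r: "r > 0" "cassini_ball p (ereal r) \<subseteq> V"
    using assms unfolding openin_cassini_topology by blast
  have "open {q. cassini q p < r}"
    unfolding cassini_def delta_quat_def by (intro open_Collect_less continuous_intros)
  moreover have "p \<in> {q. cassini q p < r}"
    using r(1) by (simp add: cassini_def)
  moreover have "{q. cassini q p < r} \<subseteq> V"
    using r(2) by (auto simp: cassini_ball_def)
  ultimately show "\<exists>T. open T \<and> p \<in> T \<and> T \<subseteq> V"
    by blast
qed

theorem theorem2p9:
  fixes D :: "'a::banach_quat_bimodule set" and A :: "'a \<Rightarrow> 'a"
    and q\<^sub>0 :: quat and R :: ereal
  assumes "right_submodule D"
    and "right_linear_on D A"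
    and "closed_operator D A"
    and "S_resolvent_set D A \<inter> \<real> \<noteq> {}"
    and "q\<^sub>0 \<in> S_resolvent_set D A"
    and "R = inv_sqrt (opnorm (Q_op D A q\<^sub>0))"
  shows "R > 0 \<and>
    (\<forall>n. B_op D A q\<^sub>0 n \<in> bounded_right_linear) \<and>
    cassini_ball q\<^sub>0 R \<subseteq> S_resolvent_set D A \<and>
    openin cassini_topology (S_resolvent_set D A) \<and>
    open (S_resolvent_set D A) \<and>
    (\<forall>q \<in> cassini_ball q\<^sub>0 R.
      op_sums (\<lambda>n. lscale_op ((-1) ^ n) (rscale_op (B_op D A q\<^sub>0 (n + 1)) (p_fun q\<^sub>0 n q)))
        (S_resolvent_op D A q))"
proof -
  interpret closed_right_operator D A
    using assms(1-3) by unfold_locales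
  note q\<^sub>0 = assms(5)
  have ball: "q \<in> cassini_ball q\<^sub>0 R \<longleftrightarrow> opnorm (Q_op D A q\<^sub>0) * norm (delta_quat q\<^sub>0 q) < 1" for q
    unfolding assms(6) by (intro mem_cassini_ball_iff opnorm_Q_op_nonneg q\<^sub>0)
  have openin: "openin cassini_topology (S_resolvent_set D A)"
    using opnorm_Q_op_nonneg S_resolvent_set_near by (intro openin_cassini_topologyI) blast
  show ?thesis
  proof (intro conjI allI ballI subsetI)
    show "R > 0"
      by (simp add: assms(6) inv_sqrt_pos)
    show "B_op D A q\<^sub>0 n \<in> bounded_right_linear" for n
      using q\<^sub>0 by (rule B_op_bounded_right_linear)
    show "open (S_resolvent_set D A)"
      using openin by (rule open_if_openin_cassini_topology)
    fix q assume "q \<in> cassini_ball q\<^sub>0 R"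
    then have less: "opnorm (Q_op D A q\<^sub>0) * norm (delta_quat q\<^sub>0 q) < 1"
      by (simp add: ball)
    show "q \<in> S_resolvent_set D A"
      using q\<^sub>0 less by (rule S_resolvent_set_near)
    show "op_sums (\<lambda>n. lscale_op ((-1) ^ n) (rscale_op (B_op D A q\<^sub>0 (n + 1)) (p_fun q\<^sub>0 n q)))
        (S_resolvent_op D A q)"
      using q\<^sub>0 less by (rule S_resolvent_op_series)
  qed (rule openin)
qed

end
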